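(* Let $q^\bot$ be a fixed propositional variable, and extend the translation $*$ (defined on Łukasiewicz formulas by $p^*=(p\lor q^\bot)\land t$, $\bot^*=q^\bot\land t$, $(A\Rightarrow B)^*=t\land(A^*\to B^* )$) to multisets elementwise, to sequents by $(\Gamma\vdash\Delta)^*=\Gamma^*\vdash\Delta^*$ and to hypersequents by $(S_1\mid\ldots\mid S_n)^*=S_1^*\mid\ldots\mid S_n^*$. Then for every hypersequent $G$ of Łukasiewicz formulas in which $q^\bot$ does not occur, $\models^*_{Ł} G$ if and only if $\models_{\mathbf{A}} G^*$.
   Context: Łukasiewicz formulas are built from propositional variables and $\bot$ using $\Rightarrow$. A sequent is a pair of finite multisets of formulas, a hypersequent a finite multiset of sequents $\Gamma_1\vdash\Delta_1\mid\ldots\mid\Gamma_n\vdash\Delta_n$. $\models^*_{Ł}G$ means: for every valuation $v$ into $[-1,0]$ with $v(\bot)=-1$, $v(A\Rightarrow B)=\min(0,v(B)-v(A))$, there is $i$ with $\sum_{A\in\Gamma_i}v(A)\le\sum_{B\in\Delta_i}v(B)$ (ordinary real sums; empty sum $0$). Formulas of abelian logic are built from propositional variables and $t$ using $+,\to,\land,\lor,\lnot$; $\models_{\mathbf{A}}H$ for a hypersequent $H$ means: for every valuation into $\mathbb{Q}$ ($t=0$, $+$ addition, $\lnot$ negation, $A\to B$ valued $v(B)-v(A)$, $\land=\min$, $\lor=\max$) some component $\Gamma_i\vdash\Delta_i$ of $H$ has $\sum v(\Gamma_i)\le\sum v(\Delta_i)$. *)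

theory Defs
  imports Complex_Main "HOL-Library.Multiset"
begin

datatype (luk_vars: 'a) luk =
    LVar 'a
  | LBot
  | LImp "'a luk" "'a luk"

datatype 'a abf =
    AVar 'a
  | ATruth
  | APlus "'a abf" "'a abf"
  | AImp "'a abf" "'a abf"
  | AAnd "'a abf" "'a abf"
  | AOr "'a abf" "'a abf"
  | ANot "'a abf"

type_synonym 'f sequent = "'f multiset \<times> 'f multiset"
type_synonym 'f hypersequent = "'f sequent multiset"

definition luk_valuation :: "('a luk \<Rightarrow> real) \<Rightarrow> bool" where
  "luk_valuation v \<longleftrightarrow>
     (\<forall>A. v A \<in> {-1..0}) \<and>
     v LBot = -1 \<and>
     (\<forall>A B. v (LImp A B) = min 0 (v B - v A))"

definition luk_valid :: "'a luk hypersequent \<Rightarrow> bool" where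
  "luk_valid G \<longleftrightarrow>
     (\<forall>v. luk_valuation v \<longrightarrow>
        (\<exists>(\<Gamma>, \<Delta>) \<in> set_mset G. (\<Sum>A\<in>#\<Gamma>. v A) \<le> (\<Sum>B\<in>#\<Delta>. v B)))"

definition ab_valuation :: "('a abf \<Rightarrow> rat) \<Rightarrow> bool" where
  "ab_valuation v \<longleftrightarrow>
     v ATruth = 0 \<and>
     (\<forall>A B. v (APlus A B) = v A + v B) \<and>
     (\<forall>A B. v (AImp A B) = v B - v A) \<and>
     (\<forall>A B. v (AAnd A B) = min (v A) (v B)) \<and>
     (\<forall>A B. v (AOr A B) = max (v A) (v B)) \<and>
     (\<forall>A. v (ANot A) = - v A)"

definition ab_valid :: "'a abf hypersequent \<Rightarrow> bool" where
  "ab_valid H \<longleftrightarrow>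
     (\<forall>v. ab_valuation v \<longrightarrow>
        (\<exists>(\<Gamma>, \<Delta>) \<in> set_mset H. (\<Sum>A\<in>#\<Gamma>. v A) \<le> (\<Sum>B\<in>#\<Delta>. v B)))"

primrec luk_trans :: "'a \<Rightarrow> 'a luk \<Rightarrow> 'a abf" where
  "luk_trans q (LVar p) = AAnd (AOr (AVar p) (AVar q)) ATruth"
| "luk_trans q LBot = AAnd (AVar q) ATruth"
| "luk_trans q (LImp A B) = AAnd ATruth (AImp (luk_trans q A) (luk_trans q B))"

definition sequent_trans :: "'a \<Rightarrow> 'a luk sequent \<Rightarrow> 'a abf sequent" where
  "sequent_trans q = (\<lambda>(\<Gamma>, \<Delta>). (image_mset (luk_trans q) \<Gamma>, image_mset (luk_trans q) \<Delta>))"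

definition hypersequent_trans :: "'a \<Rightarrow> 'a luk hypersequent \<Rightarrow> 'a abf hypersequent" where
  "hypersequent_trans q G = image_mset (sequent_trans q) G"

definition occurs_in :: "'a \<Rightarrow> 'a luk hypersequent \<Rightarrow> bool" where
  "occurs_in q G \<longleftrightarrow>
     (\<exists>(\<Gamma>, \<Delta>) \<in> set_mset G. \<exists>A \<in> set_mset \<Gamma> \<union> set_mset \<Delta>. q \<in> luk_vars A)"

end

(* A valuation into the rationals with v(q) = b < 0 sends A* to -b times the Lukasiewicz value of A
   under the valuation p |-> v(p)/(-b) clamped to [-1,0], and one with b >= 0 sends every A* to 0.
   Hence only the density of the rationals remains: formulas are continuous in the values of the
   variables, so a real valuation strictly refuting all components of G can be replaced by a
   rational one; it is extended by q |-> -1, which is harmless as q does not occur in G. *)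
theory Submission
  imports Defs
begin

text \<open>Variables are clamped to [-1,0], so every real assignment yields a valuation. The clamp
  mirrors the translation of a variable \<open>p\<close> as \<open>(p \<or> q) \<and> t\<close>,
  with -1 in the role of \<open>q\<close> and 0 in the role of \<open>t\<close>.\<close>

primrec luk_eval :: "('a \<Rightarrow> real) \<Rightarrow> 'a luk \<Rightarrow> real" where
  "luk_eval f (LVar p) = min (max (f p) (-1)) 0"
| "luk_eval f LBot = -1"
| "luk_eval f (LImp A B) = min 0 (luk_eval f B - luk_eval f A)"

lemma luk_eval_bounds: "-1 \<le> luk_eval f A \<and> luk_eval f A \<le> 0"
  by (induction A) auto

lemma luk_valuation_luk_eval: "luk_valuation (luk_eval f)"
  using luk_eval_bounds by (auto simp: luk_valuation_def)

text \<open>A valuation already takes values in [-1,0], so the clamp does nothing. Hence the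
  valuations are exactly the functions \<open>luk_eval f\<close>, and it suffices to work with
  assignments to variables.\<close>

lemma luk_valuation_eq_luk_eval:
  assumes "luk_valuation v"
  shows "v A = luk_eval (\<lambda>p. v (LVar p)) A"
proof (induction A)
  case (LVar p)
  have "v (LVar p) \<in> {-1..0}"
    using assms unfolding luk_valuation_def by blast
  then show ?case by simp
qed (use assms in \<open>simp_all add: luk_valuation_def\<close>)

lemma luk_eval_cong: "(\<And>p. p \<in> luk_vars A \<Longrightarrow> f p = g p) \<Longrightarrow> luk_eval f A = luk_eval g A"
  by (induction A) auto

text \<open>Each clause of \<open>luk_eval\<close> is continuous. A formula has finitely many
  variables, so pointwise convergence of the assignments is enough.\<close>

lemma tendsto_luk_eval:
  assumes "\<And>p. ((\<lambda>n. f n p) \<longlongrightarrow> g p) F"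
  shows "((\<lambda>n. luk_eval (f n) A) \<longlongrightarrow> luk_eval g A) F"
  by (induction A) (auto intro!: tendsto_intros tendsto_min tendsto_max assms)

lemma tendsto_sum_mset:
  fixes f :: "'b \<Rightarrow> 'a \<Rightarrow> real"
  assumes "\<And>x. ((\<lambda>n. f n x) \<longlongrightarrow> g x) F"
  shows "((\<lambda>n. \<Sum>x\<in>#M. f n x) \<longlongrightarrow> (\<Sum>x\<in>#M. g x)) F"
  by (induction M) (auto intro!: tendsto_intros assms)

text \<open>Supplies an abelian valuation with prescribed values on the variables.\<close>

primrec ab_eval :: "('a \<Rightarrow> rat) \<Rightarrow> 'a abf \<Rightarrow> rat" where
  "ab_eval f (AVar p) = f p"
| "ab_eval f ATruth = 0"
| "ab_eval f (APlus A B) = ab_eval f A + ab_eval f B"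
| "ab_eval f (AImp A B) = ab_eval f B - ab_eval f A"
| "ab_eval f (AAnd A B) = min (ab_eval f A) (ab_eval f B)"
| "ab_eval f (AOr A B) = max (ab_eval f A) (ab_eval f B)"
| "ab_eval f (ANot A) = - ab_eval f A"

lemma ab_valuation_ab_eval: "ab_valuation (ab_eval f)"
  by (simp add: ab_valuation_def)

lemma of_rat_min: "(of_rat (min x y) :: real) = min (of_rat x) (of_rat y)"
  by (simp add: min_def of_rat_less_eq)

lemma of_rat_max: "(of_rat (max x y) :: real) = max (of_rat x) (of_rat y)"
  by (simp add: max_def of_rat_less_eq)

lemma of_rat_sum_mset: "(of_rat (\<Sum>x\<in>#M. f x) :: real) = (\<Sum>x\<in>#M. of_rat (f x))"
  by (induction M) (auto simp: of_rat_add)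

text \<open>Multiplication by a positive \<open>c\<close> commutes with min, max and differences. In
  the base cases \<open>min (max x (-c)) 0\<close> is \<open>c\<close> times the clamp of
  \<open>x / c\<close>, and \<open>min (-c) 0\<close> is \<open>c\<close> times -1.\<close>

lemma of_rat_luk_trans:
  fixes v :: "'a abf \<Rightarrow> rat"
  assumes v: "ab_valuation v" and c: "c = - v (AVar q)" "c > 0"
  shows "(of_rat (v (luk_trans q A)) :: real)
       = of_rat c * luk_eval (\<lambda>p. of_rat (v (AVar p) / c)) A"
proof -
  let ?c = "of_rat c :: real"
  have pos: "?c > 0" using c by simp
  have vq: "v (AVar q) = - c" using c by simp
  have dist: "?c * min x y = min (?c * x) (?c * y)" "?c * max x y = max (?c * x) (?c * y)" for x y
    using pos by (auto simp: min_def max_def)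
  show ?thesis
    using v pos by (induction A) (auto simp: ab_valuation_def vq of_rat_min of_rat_max dist
      of_rat_divide of_rat_minus of_rat_diff right_diff_distrib)
qed

text \<open>The meet with \<open>t\<close> caps every translation at 0. At variables and
  \<open>LBot\<close> the value of \<open>q\<close> pushes the other argument of the meet up to at
  least 0; at implications it is 0 - 0 by induction.\<close>

lemma luk_trans_eq_0:
  assumes "ab_valuation v" "v (AVar q) \<ge> 0"
  shows "v (luk_trans q A) = 0"
  using assms by (induction A) (auto simp: ab_valuation_def)

text \<open>Both sums scale by the same positive factor \<open>c\<close>, which cancels.\<close>

lemma luk_trans_sum_le_iff:
  assumes "ab_valuation v" "c = - v (AVar q)" "c > 0"
  shows "(\<Sum>A\<in>#\<Gamma>. v (luk_trans q A)) \<le> (\<Sum>A\<in>#\<Delta>. v (luk_trans q A)) \<longleftrightarrow>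
    (\<Sum>A\<in>#\<Gamma>. luk_eval (\<lambda>p. of_rat (v (AVar p) / c)) A)
      \<le> (\<Sum>A\<in>#\<Delta>. luk_eval (\<lambda>p. of_rat (v (AVar p) / c)) A)"
proof -
  have "(of_rat (\<Sum>A\<in>#M. v (luk_trans q A)) :: real)
      = of_rat c * (\<Sum>A\<in>#M. luk_eval (\<lambda>p. of_rat (v (AVar p) / c)) A)" for M
    by (simp only: of_rat_sum_mset of_rat_luk_trans[OF assms] sum_mset_distrib_left)
  moreover have "(of_rat c :: real) > 0"
    using assms by simp
  ultimately show ?thesis
    by (metis mult_le_cancel_left_pos of_rat_less_eq)
qed

lemma ab_valid_hypersequent_trans_iff:
  "ab_valid (hypersequent_trans q G) \<longleftrightarrow>
    (\<forall>v. ab_valuation v \<longrightarrow> (\<exists>(\<Gamma>, \<Delta>) \<in> set_mset G.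
      (\<Sum>A\<in>#\<Gamma>. v (luk_trans q A)) \<le> (\<Sum>B\<in>#\<Delta>. v (luk_trans q B))))"
  by (simp add: ab_valid_def hypersequent_trans_def sequent_trans_def case_prod_unfold
      multiset.map_comp comp_def)

lemma exists_rational_luk_refutation:
  assumes "\<forall>(\<Gamma>, \<Delta>) \<in> set_mset G. (\<Sum>B\<in>#\<Delta>. luk_eval f B) < (\<Sum>A\<in>#\<Gamma>. luk_eval f A)"
  shows "\<exists>r :: 'a \<Rightarrow> rat. \<forall>(\<Gamma>, \<Delta>) \<in> set_mset G.
    (\<Sum>B\<in>#\<Delta>. luk_eval (\<lambda>p. of_rat (r p)) B) < (\<Sum>A\<in>#\<Gamma>. luk_eval (\<lambda>p. of_rat (r p)) A)"
proof -
  have "\<exists>r. \<bar>of_rat r - f p\<bar> < inverse (real (Suc n))" for n :: nat and p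
  proof -
    have "f p < f p + inverse (real (Suc n))" by simp
    then obtain r where "f p < of_rat r" "of_rat r < f p + inverse (real (Suc n))"
      using of_rat_dense by blast
    then show ?thesis by (intro exI[of _ r]) linarith
  qed
  then have "\<forall>n p. \<exists>r. \<bar>of_rat r - f p\<bar> < inverse (real (Suc n))"
    by blast
  \<comment> \<open>The approximations are chosen separately for each variable, even if there are
    infinitely many; only pointwise convergence to \<open>f\<close> is required.\<close>
  then obtain r where r: "\<And>n p. \<bar>of_rat (r n p) - f p\<bar> < inverse (real (Suc n))"
    unfolding choice_iff by blast
  have "(\<lambda>n. of_rat (r n p) :: real) \<longlonglongrightarrow> f p" for p
  proof (rule LIM_zero_cancel, rule tendsto_rabs_zero_cancel,
      rule tendsto_sandwich[where f = "\<lambda>_. 0" and h = "\<lambda>n. inverse (real (Suc n))"])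
    show "(\<lambda>n. inverse (real (Suc n))) \<longlonglongrightarrow> 0"
      by (rule LIMSEQ_inverse_real_of_nat)
    show "\<forall>\<^sub>F n in sequentially. \<bar>of_rat (r n p) - f p\<bar> \<le> inverse (real (Suc n))"
      by (rule always_eventually) (use r in \<open>auto intro: less_imp_le\<close>)
  qed auto
  then have lim: "(\<lambda>n. \<Sum>A\<in>#M. luk_eval (\<lambda>p. of_rat (r n p)) A) \<longlonglongrightarrow> (\<Sum>A\<in>#M. luk_eval f A)" for M
    by (intro tendsto_sum_mset tendsto_luk_eval)
  have "\<forall>\<^sub>F n in sequentially. \<forall>S \<in> set_mset G.
      (\<Sum>B\<in>#snd S. luk_eval (\<lambda>p. of_rat (r n p)) B) < (\<Sum>A\<in>#fst S. luk_eval (\<lambda>p. of_rat (r n p)) A)"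
  \<comment> \<open>\<open>G\<close> has finitely many components, so one index \<open>n\<close> can
    serve all of them once each is eventually refuted.\<close>
  proof (intro eventually_ball_finite ballI finite_set_mset)
    fix S assume "S \<in># G"
    \<comment> \<open>The difference of the two sums has a positive limit, so it is eventually
      positive.\<close>
    then have "0 < (\<Sum>A\<in>#fst S. luk_eval f A) - (\<Sum>B\<in>#snd S. luk_eval f B)"
      using assms by auto
    from order_tendstoD(1)[OF tendsto_diff[OF lim lim] this]
    show "\<forall>\<^sub>F n in sequentially. (\<Sum>B\<in>#snd S. luk_eval (\<lambda>p. of_rat (r n p)) B)
        < (\<Sum>A\<in>#fst S. luk_eval (\<lambda>p. of_rat (r n p)) A)"
      by simp
  qed
  then obtain n where "\<forall>S \<in> set_mset G.
      (\<Sum>B\<in>#snd S. luk_eval (\<lambda>p. of_rat (r n p)) B) < (\<Sum>A\<in>#fst S. luk_eval (\<lambda>p. of_rat (r n p)) A)"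
    using eventually_happens'[OF sequentially_bot] by blast
  then show ?thesis by (intro exI[of _ "r n"]) auto
qed

theorem mainTheorem6:
  fixes q :: 'a and G :: "'a luk hypersequent"
  assumes "\<not> occurs_in q G"
  shows "luk_valid G \<longleftrightarrow> ab_valid (hypersequent_trans q G)"
proof
  assume valid: "luk_valid G"
  show "ab_valid (hypersequent_trans q G)"
    unfolding ab_valid_hypersequent_trans_iff
  proof (intro allI impI)
    fix v :: "'a abf \<Rightarrow> rat"
    assume v: "ab_valuation v"
    show "\<exists>(\<Gamma>, \<Delta>) \<in> set_mset G.
      (\<Sum>A\<in>#\<Gamma>. v (luk_trans q A)) \<le> (\<Sum>B\<in>#\<Delta>. v (luk_trans q B))"
    proof (cases "v (AVar q) \<ge> 0")
      case True
      \<comment> \<open>All sums vanish in this case, so any component will do. One exists because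
        an empty hypersequent is never valid.\<close>
      have "\<exists>S. S \<in> set_mset G"
        using valid luk_valuation_luk_eval unfolding luk_valid_def by blast
      then show ?thesis
        by (auto simp: luk_trans_eq_0[OF v True])
    next
      case False
      then have "- v (AVar q) > 0" by simp
      from luk_trans_sum_le_iff[OF v refl this] show ?thesis
        using valid[unfolded luk_valid_def, rule_format, OF luk_valuation_luk_eval] by simp
    qed
  qed
next
  assume valid: "ab_valid (hypersequent_trans q G)"
  show "luk_valid G"
  proof (rule ccontr)
    assume "\<not> luk_valid G"
    then obtain u where u: "luk_valuation u"
      and "\<forall>(\<Gamma>, \<Delta>) \<in> set_mset G. (\<Sum>B\<in>#\<Delta>. u B) < (\<Sum>A\<in>#\<Gamma>. u A)"
      by (fastforce simp: luk_valid_def not_le)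
    then have "\<forall>(\<Gamma>, \<Delta>) \<in> set_mset G. (\<Sum>B\<in>#\<Delta>. luk_eval (\<lambda>p. u (LVar p)) B)
        < (\<Sum>A\<in>#\<Gamma>. luk_eval (\<lambda>p. u (LVar p)) A)"
      by (simp flip: luk_valuation_eq_luk_eval[OF u])
    from exists_rational_luk_refutation[OF this] obtain r :: "'a \<Rightarrow> rat" where
      r: "\<forall>(\<Gamma>, \<Delta>) \<in> set_mset G. (\<Sum>B\<in>#\<Delta>. luk_eval (\<lambda>p. of_rat (r p)) B)
        < (\<Sum>A\<in>#\<Gamma>. luk_eval (\<lambda>p. of_rat (r p)) A)"
      by blast
    \<comment> \<open>The value -1 at \<open>q\<close> makes the scaling factor \<open>c\<close>
      equal to 1, so translations evaluate to the values of the original formulas.\<close>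
    define v where "v = ab_eval (r(q := -1))"
    have v: "ab_valuation v" "1 = - v (AVar q)"
      by (simp_all add: v_def ab_valuation_ab_eval)
    \<comment> \<open>Overwriting \<open>r\<close> at \<open>q\<close> is invisible to the formulas
      of \<open>G\<close>, since \<open>q\<close> does not occur in them.\<close>
    have eq: "luk_eval (\<lambda>p. of_rat (v (AVar p) / 1)) A = luk_eval (\<lambda>p. of_rat (r p)) A"
      if "(\<Gamma>, \<Delta>) \<in># G" "A \<in># \<Gamma> \<or> A \<in># \<Delta>" for \<Gamma> \<Delta> A
      by (rule luk_eval_cong) (use assms that in \<open>auto simp: occurs_in_def v_def\<close>)
    obtain \<Gamma> \<Delta> where S: "(\<Gamma>, \<Delta>) \<in># G"
      and "(\<Sum>A\<in>#\<Gamma>. v (luk_trans q A)) \<le> (\<Sum>B\<in>#\<Delta>. v (luk_trans q B))"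
      using valid v(1) unfolding ab_valid_hypersequent_trans_iff by blast
    then have "(\<Sum>A\<in>#\<Gamma>. luk_eval (\<lambda>p. of_rat (v (AVar p) / 1)) A)
        \<le> (\<Sum>B\<in>#\<Delta>. luk_eval (\<lambda>p. of_rat (v (AVar p) / 1)) B)"
      using luk_trans_sum_le_iff[OF v] by simp
    moreover have "(\<Sum>A\<in>#M. luk_eval (\<lambda>p. of_rat (v (AVar p) / 1)) A)
        = (\<Sum>A\<in>#M. luk_eval (\<lambda>p. of_rat (r p)) A)" if "M = \<Gamma> \<or> M = \<Delta>" for M
      by (intro arg_cong[of _ _ sum_mset] image_mset_cong eq[OF S]) (use that in auto)
    ultimately have "(\<Sum>A\<in>#\<Gamma>. luk_eval (\<lambda>p. of_rat (r p)) A)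
        \<le> (\<Sum>B\<in>#\<Delta>. luk_eval (\<lambda>p. of_rat (r p)) B)"
      by simp
    with bspec[OF r S] show False by simp
  qed
qed

end
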